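(* Let $p$ be a prime, $n\ge 0$ an integer, $G$ a finite group, and $P$ a nonabelian Sylow $p$-subgroup of $G$. Suppose that $P$ has nilpotence class at most $n(p-1)+1$ and that $G$ has no nontrivial strongly closed abelian $p$-subgroup. Then $Z(P)$ has exponent at most $p^n$.
   Context: A subgroup $A \le P$ is strongly closed (in $P$ with respect to $G$) if for every $a\in A$ and $g\in G$ with $gag^{-1}\in P$, one has $gag^{-1}\in A$. *)

theory Defs
  imports "HOL-Algebra.Algebra" "HOL-Computational_Algebra.Primes"
begin

definition sylow_subgroup :: "('a, 'b) monoid_scheme \<Rightarrow> nat \<Rightarrow> 'a set \<Rightarrow> bool" where
  "sylow_subgroup G p P \<longleftrightarrow> subgroup P G \<and> card P = p ^ multiplicity p (order G)"

definition abelian_set :: "('a, 'b) monoid_scheme \<Rightarrow> 'a set \<Rightarrow> bool" where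
  "abelian_set G S \<longleftrightarrow> (\<forall>x\<in>S. \<forall>y\<in>S. x \<otimes>\<^bsub>G\<^esub> y = y \<otimes>\<^bsub>G\<^esub> x)"

definition center_of :: "('a, 'b) monoid_scheme \<Rightarrow> 'a set \<Rightarrow> 'a set" where
  "center_of G P = {z \<in> P. \<forall>x\<in>P. z \<otimes>\<^bsub>G\<^esub> x = x \<otimes>\<^bsub>G\<^esub> z}"

definition commutator :: "('a, 'b) monoid_scheme \<Rightarrow> 'a \<Rightarrow> 'a \<Rightarrow> 'a" where
  "commutator G x y = x \<otimes>\<^bsub>G\<^esub> y \<otimes>\<^bsub>G\<^esub> inv\<^bsub>G\<^esub> x \<otimes>\<^bsub>G\<^esub> inv\<^bsub>G\<^esub> y"

(* lower central series of P: lcs G P i = gamma_{i+1}(P) *)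
fun lcs :: "('a, 'b) monoid_scheme \<Rightarrow> 'a set \<Rightarrow> nat \<Rightarrow> 'a set" where
  "lcs G P 0 = P"
| "lcs G P (Suc i) = generate G {commutator G x y | x y. x \<in> lcs G P i \<and> y \<in> P}"

definition nilpotence_class_le :: "('a, 'b) monoid_scheme \<Rightarrow> 'a set \<Rightarrow> nat \<Rightarrow> bool" where
  "nilpotence_class_le G P c \<longleftrightarrow> lcs G P c = {\<one>\<^bsub>G\<^esub>}"

definition strongly_closed :: "('a, 'b) monoid_scheme \<Rightarrow> 'a set \<Rightarrow> 'a set \<Rightarrow> bool" where
  "strongly_closed G P A \<longleftrightarrow> subgroup A G \<and> A \<subseteq> P \<and>
     (\<forall>a\<in>A. \<forall>g\<in>carrier G. g \<otimes>\<^bsub>G\<^esub> a \<otimes>\<^bsub>G\<^esub> inv\<^bsub>G\<^esub> g \<in> P \<longrightarrow>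
        g \<otimes>\<^bsub>G\<^esub> a \<otimes>\<^bsub>G\<^esub> inv\<^bsub>G\<^esub> g \<in> A)"

end

theory Submission
  imports Defs "HOL-Computational_Algebra.Polynomial" "HOL-Algebra.Left_Coset"
begin

text \<open>
  Put \<open>q = p^n\<close>. The subgroup \<open>A\<close> of \<open>q\<close>-th powers of elements of \<open>Z(P)\<close> is strongly closed, hence
  trivial. The point is that a \<open>q\<close>-th power \<open>b\<close> of an element of \<open>Z(T)\<close>, \<open>T\<close> Sylow, is central in
  every Sylow subgroup \<open>S\<close> containing it; conjugacy of Sylow subgroups of \<open>C(b)\<close> does the rest.

  Take a counterexample with \<open>|S \<inter> T|\<close> maximal. After conjugating \<open>T\<close> in \<open>C(b)\<close>, the intersection is
  \<open>R = C_S(b)\<close>, and Sylow's theorem in \<open>N(R)\<close> together with maximality writes \<open>b\<close> as the \<open>q\<close>-th power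
  of some \<open>y \<in> Z(R)\<close>. Choose \<open>x \<in> S - R\<close> normalizing \<open>R\<close> with \<open>x^p \<in> R\<close>. On \<open>Z(R)\<close>, written additively,
  the conjugation \<open>t\<close> by \<open>x\<close> satisfies \<open>t^p = 1\<close>, and the bound on the class gives
  \<open>(1 - t)^(n(p-1)+1) y = 0\<close>. The two polynomials \<open>1 - t^p\<close> and \<open>(1 - t)^(n(p-1)+1)\<close> generate an
  ideal of \<open>\<int>[t]\<close> containing \<open>q (1 - t)\<close>. So \<open>x\<close> centralizes \<open>b\<close>, contradicting \<open>x \<notin> C_S(b)\<close>.
\<close>

subsection \<open>Polynomials in an endomorphism of an abelian group\<close>

text \<open>In the binomial expansion of \<open>(1 - s) ^ p\<close> the coefficients strictly
  between the ends are divisible by \<open>p\<close>, and from index 2 on these terms also contain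
  \<open>s * s\<close>. The summand \<open>(- s) ^ p\<close> keeps its sign inside so that
  \<open>p = 2\<close> and odd \<open>p\<close> are treated alike.\<close>

lemma one_minus_power_prime:
  fixes s :: "'a::comm_ring_1"
  assumes "Factorial_Ring.prime (p::nat)"
  obtains h where "1 - (1 - s) ^ p = of_nat p * s * (1 - s * h) - (- s) ^ p"
proof -
  have p2: "p \<ge> 2" using assms by (rule prime_ge_2_nat)
  define d where "d i = (p choose i) div p" for i
  have d: "of_nat (p choose i) = (of_nat p * of_nat (d i) :: 'a)" if "i \<in> {2..<p}" for i
  proof -
    have "p dvd (p choose i)" using that assms by (intro dvd_choose_prime) auto
    then show ?thesis unfolding d_def by (metis dvd_mult_div_cancel of_nat_mult)
  qed
  \<comment> \<open>The middle terms of the expansion, divided by \<open>p * s ^ 2\<close>.\<close>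
  define h where "h = (\<Sum>i\<in>{2..<p}. of_nat (d i) * (- s) ^ (i - 2))"
  have split: "{..p} = insert 0 (insert 1 (insert p {2..<p}))" using p2 by auto
  have "(1 - s) ^ p = (\<Sum>i\<le>p. of_nat (p choose i) * (- s) ^ i)"
    using binomial_ring[of "- s" 1 p] by (simp add: add.commute)
  also have "\<dots> = 1 - of_nat p * s + (- s) ^ p + (\<Sum>i\<in>{2..<p}. of_nat (p choose i) * (- s) ^ i)"
    unfolding split using p2 by (simp add: algebra_simps)
  also have "(\<Sum>i\<in>{2..<p}. of_nat (p choose i) * (- s) ^ i) = of_nat p * s * (s * h)"
    unfolding h_def sum_distrib_left
  proof (rule sum.cong[OF refl])
    fix i assume i: "i \<in> {2..<p}"
    then obtain j where j: "i = j + 2" by (metis add.commute atLeastLessThan_iff le_Suc_ex)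
    show "of_nat (p choose i) * (- s) ^ i
        = of_nat p * s * (s * (of_nat (d i) * (- s) ^ (i - 2)))"
      unfolding d[OF i] by (simp add: j power_add power2_eq_square algebra_simps)
  qed
  finally show thesis by (intro that[of h]) (simp add: algebra_simps)
qed

text \<open>
  Modulo the ideal, \<open>p s (1 - s h) = (- s)^p\<close>, and \<open>1 - s h\<close> is invertible up to high powers of \<open>s\<close>: so
  each factor \<open>p\<close> trades for \<open>p - 1\<close> factors \<open>s\<close>.
\<close>

lemma prime_power_in_ideal:
  fixes s :: "'a::comm_ring_1" and J :: "'a set"
  assumes p: "Factorial_Ring.prime (p::nat)"
    and add: "\<And>f g. f \<in> J \<Longrightarrow> g \<in> J \<Longrightarrow> f + g \<in> J"
    and mul: "\<And>f g. f \<in> J \<Longrightarrow> g * f \<in> J"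
    and s: "s ^ (n * (p - 1) + 1) \<in> J" and N: "1 - (1 - s) ^ p \<in> J"
  shows "of_nat (p ^ n) * s \<in> J"
proof -
  obtain h where h: "1 - (1 - s) ^ p = of_nat p * s * (1 - s * h) - (- s) ^ p"
    using one_minus_power_prime[OF p] by blast
  have p2: "p \<ge> 2" using p by (rule prime_ge_2_nat)
  have diff: "f - g \<in> J" if "f \<in> J" "g \<in> J" for f g
    using add[OF that(1) mul[OF that(2), of "-1"]] by simp
  have step: "of_nat p * u * s ^ (k + 1) \<in> J" if u: "u * s ^ (k + p) \<in> J" for u k
  proof -
    define M where "M = p - 1"
    have kp: "k + p = (k + 1) + M" using p2 by (simp add: M_def)
    have "of_nat p * u * s ^ (k + 1) * (1 - s * h) =
        u * s ^ k * (1 - (1 - s) ^ p) + (- 1) ^ p * (u * s ^ (k + p))"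
      unfolding h power_minus[of s] by (simp add: power_add algebra_simps)
    then have 1: "of_nat p * u * s ^ (k + 1) * (1 - s * h) \<in> J"
      using N u by (simp add: add mul)
    \<comment> \<open>A truncated geometric series inverts \<open>1 - s * h\<close> up to
      \<open>(s * h) ^ M\<close>. With \<open>M = p - 1\<close> the error term, multiplied by
      \<open>s ^ (k + 1)\<close>, contains \<open>s ^ (k + p)\<close> and so falls into
      \<open>J\<close>.\<close>
    have geom: "1 = (\<Sum>i<M. (s * h) ^ i) * (1 - s * h) + (s * h) ^ M"
      using one_diff_power_eq[of "s * h" M] by (simp add: algebra_simps)
    have "of_nat p * u * s ^ (k + 1) =
       of_nat p * u * s ^ (k + 1) * ((\<Sum>i<M. (s * h) ^ i) * (1 - s * h) + (s * h) ^ M)"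
      using geom by simp
    also have "\<dots> = (\<Sum>i<M. (s * h) ^ i) * (of_nat p * u * s ^ (k + 1) * (1 - s * h))
       + of_nat p * u * s ^ (k + 1) * (s * h) ^ M"
      by (simp only: distrib_left ac_simps)
    also have "of_nat p * u * s ^ (k + 1) * (s * h) ^ M = of_nat p * h ^ M * (u * s ^ (k + p))"
      unfolding kp power_add[of s "k + 1"] power_mult_distrib by (simp only: ac_simps)
    finally show ?thesis using 1 u by (metis add mul)
  qed
  \<comment> \<open>Here \<open>i\<close> counts the factors \<open>p\<close> already gained and
    \<open>j\<close> the blocks of \<open>p - 1\<close> factors \<open>s\<close> still left;
    \<open>i = 0\<close> is the hypothesis on \<open>s\<close> and \<open>i = n\<close> the
    claim.\<close>
  have "of_nat (p ^ i) * s ^ (j * (p - 1) + 1) \<in> J" if "i + j = n" for i j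
    using that
  proof (induction i arbitrary: j)
    case 0
    then show ?case using s by simp
  next
    case (Suc i)
    have "Suc j * (p - 1) + 1 = j * (p - 1) + p" using p2 by simp
    then have "of_nat (p ^ i) * s ^ (j * (p - 1) + p) \<in> J"
      using Suc.IH[of "Suc j"] Suc.prems by (simp add: add.commute)
    from step[OF this] show ?case by simp
  qed
  from this[of n 0] show ?thesis by simp
qed

context comm_group
begin

text \<open>The action of \<open>\<int>[t]\<close> on the abelian group, with \<open>t\<close> acting as \<open>\<sigma>\<close>.\<close>

definition poly_act :: "('a \<Rightarrow> 'a) \<Rightarrow> int poly \<Rightarrow> 'a \<Rightarrow> 'a" where
  "poly_act \<sigma> f v = foldr (\<lambda>a r. v [^] a \<otimes> \<sigma> r) (coeffs f) \<one>"

lemma poly_act_0 [simp]: "poly_act \<sigma> 0 v = \<one>"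
  by (simp add: poly_act_def)

context
  fixes \<sigma> v
  assumes \<sigma>: "\<sigma> \<in> hom G G" and v [simp]: "v \<in> carrier G"
begin

lemma endo_one: "\<sigma> \<one> = \<one>"
  using \<sigma> by (simp add: hom_one)

lemma endo_closed: "x \<in> carrier G \<Longrightarrow> \<sigma> x \<in> carrier G"
  using \<sigma> by (auto simp: hom_def)

lemma endo_mult: "x \<in> carrier G \<Longrightarrow> y \<in> carrier G \<Longrightarrow> \<sigma> (x \<otimes> y) = \<sigma> x \<otimes> \<sigma> y"
  using \<sigma> by (auto simp: hom_def)

lemma endo_int_pow: "x \<in> carrier G \<Longrightarrow> \<sigma> (x [^] (k::int)) = \<sigma> x [^] k"
  using \<sigma> by (metis group_axioms group_hom.hom_int_pow group_hom_axioms.intro group_hom.intro)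

lemma poly_act_pCons: "poly_act \<sigma> (pCons a f) v = v [^] a \<otimes> \<sigma> (poly_act \<sigma> f v)"
  \<comment> \<open>The zero polynomial has an empty coefficient list, so the Horner step for
    \<open>pCons 0 0\<close> rests on \<open>\<sigma> \<one> = \<one>\<close>.\<close>
  by (cases "a = 0 \<and> f = 0") (auto simp: poly_act_def cCons_def endo_one)

lemma poly_act_closed [simp]: "poly_act \<sigma> f v \<in> carrier G"
  by (induction f) (auto simp: poly_act_pCons endo_closed)

lemma poly_act_add: "poly_act \<sigma> (f + g) v = poly_act \<sigma> f v \<otimes> poly_act \<sigma> g v"
proof (induction f g rule: poly_induct2)
  case (pCons a f b g)
  then show ?case
    by (simp add: poly_act_pCons endo_mult endo_closed int_pow_mult m_ac)
qed simp

lemma poly_act_smult: "poly_act \<sigma> (smult c f) v = poly_act \<sigma> f v [^] c"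
proof (induction f)
  case (pCons a f)
  then show ?case
    by (simp add: poly_act_pCons endo_int_pow endo_closed int_pow_distrib int_pow_pow mult.commute)
qed simp

text \<open>\<open>pCons a g * f\<close> is \<open>smult a f\<close> plus the shift of
  \<open>g * f\<close>, and both summands kill \<open>v\<close>. With additivity, the annihilator of
  \<open>v\<close> is thus an ideal that can serve as \<open>J\<close> in
  \<open>prime_power_in_ideal\<close>.\<close>

lemma poly_act_mult_eq_one:
  assumes "poly_act \<sigma> f v = \<one>"
  shows "poly_act \<sigma> (g * f) v = \<one>"
proof (induction g)
  case (pCons a g)
  then show ?case
    using assms by (simp add: poly_act_add poly_act_smult poly_act_pCons endo_one)
qed simp

lemma poly_act_shift: "poly_act \<sigma> ([:0, 1:] * f) v = \<sigma> (poly_act \<sigma> f v)"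
  by (simp add: poly_act_pCons endo_closed)

lemma poly_act_one: "poly_act \<sigma> 1 v = v"
  by (simp add: one_pCons poly_act_pCons endo_one)

lemma poly_act_uminus: "poly_act \<sigma> (- f) v = inv poly_act \<sigma> f v"
  using poly_act_smult[of "-1" f] by (simp add: int_pow_neg)

lemma poly_act_diff: "poly_act \<sigma> (f - g) v = poly_act \<sigma> f v \<otimes> inv poly_act \<sigma> g v"
  using poly_act_add[of f "- g"] by (simp add: poly_act_uminus)

lemma poly_act_shift_power: "poly_act \<sigma> ([:0, 1:] ^ k) v = (\<sigma> ^^ k) v"
  by (induction k) (simp_all add: poly_act_one poly_act_shift del: mult_pCons_left)

text \<open>Written multiplicatively, \<open>1 - t\<close> is the map
  \<open>u \<mapsto> u \<otimes> inv \<sigma> u\<close>; when \<sigma> is a conjugation, its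
  iterates are iterated commutators.\<close>

lemma poly_act_diff_power:
  "poly_act \<sigma> ((1 - [:0, 1:]) ^ k) v = ((\<lambda>u. u \<otimes> inv \<sigma> u) ^^ k) v"
proof (induction k)
  case (Suc k)
  show ?case
    using poly_act_diff[of "(1 - [:0, 1:]) ^ k" "[:0, 1:] * (1 - [:0, 1:]) ^ k"]
    by (simp add: Suc.IH poly_act_shift left_diff_distrib del: mult_pCons_left)
qed (simp add: poly_act_one)

text \<open>The ideal lemma is applied with \<open>s = 1 - t\<close> and the annihilator of
  \<open>v\<close> as ideal: \<open>p ^ n * (1 - t)\<close> kills \<open>v\<close>, which says that
  \<sigma> fixes the \<open>p ^ n\<close>-th power of \<open>v\<close>.\<close>

lemma endo_fixes_prime_power:
  assumes p: "Factorial_Ring.prime (p::nat)" and per: "(\<sigma> ^^ p) v = v"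
    and unip: "((\<lambda>u. u \<otimes> inv \<sigma> u) ^^ (n * (p - 1) + 1)) v = \<one>"
  shows "\<sigma> (v [^] (p ^ n)) = v [^] (p ^ n)"
proof -
  let ?t = "[:0, 1:] :: int poly"
  have "of_nat (p ^ n) * (1 - ?t) \<in> {f. poly_act \<sigma> f v = \<one>}"
  proof (rule prime_power_in_ideal[OF p])
    show "(1 - ?t) ^ (n * (p - 1) + 1) \<in> {f. poly_act \<sigma> f v = \<one>}"
      using unip unfolding mem_Collect_eq poly_act_diff_power .
    have "poly_act \<sigma> (1 - ?t ^ p) v = \<one>"
      unfolding poly_act_diff poly_act_shift_power by (simp add: per poly_act_one)
    then show "1 - (1 - (1 - ?t)) ^ p \<in> {f. poly_act \<sigma> f v = \<one>}" by simp
  qed (simp_all add: poly_act_add poly_act_mult_eq_one)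
  then have "poly_act \<sigma> (smult (int (p ^ n)) (1 - ?t)) v = \<one>"
    by (simp only: of_nat_poly mem_Collect_eq) simp
  moreover have "poly_act \<sigma> (1 - ?t) v = v \<otimes> inv \<sigma> v"
    using poly_act_diff_power[of 1] by simp
  ultimately have "(v \<otimes> inv \<sigma> v) [^] int (p ^ n) = \<one>"
    by (simp only: poly_act_smult)
  then have "v [^] int (p ^ n) \<otimes> inv (\<sigma> (v [^] int (p ^ n))) = \<one>"
    by (simp add: int_pow_distrib endo_closed endo_int_pow int_pow_inv)
  then have "v [^] int (p ^ n) = \<sigma> (v [^] int (p ^ n))"
    by (metis endo_closed int_pow_closed inv_closed inv_equality inv_inv v)
  then show ?thesis by (simp only: int_pow_int)
qed

end

end

subsection \<open>Conjugation and the lower central series\<close>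

definition conj_by :: "('a, 'b) monoid_scheme \<Rightarrow> 'a \<Rightarrow> 'a \<Rightarrow> 'a" where
  "conj_by G g x = g \<otimes>\<^bsub>G\<^esub> x \<otimes>\<^bsub>G\<^esub> inv\<^bsub>G\<^esub> g"

text \<open>For a subgroup \<open>S\<close> the center is abelian, so the plain set of
  \<open>q\<close>-th powers is already a subgroup and no generated subgroup is taken.\<close>

definition central_power :: "('a, 'b) monoid_scheme \<Rightarrow> 'a set \<Rightarrow> nat \<Rightarrow> 'a set" where
  "central_power G S q = (\<lambda>z. z [^]\<^bsub>G\<^esub> q) ` center_of G S"

context group
begin

lemma conj_by_closed [simp]:
  "g \<in> carrier G \<Longrightarrow> x \<in> carrier G \<Longrightarrow> conj_by G g x \<in> carrier G"
  by (simp add: conj_by_def)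

lemma conj_by_mult:
  "g \<in> carrier G \<Longrightarrow> x \<in> carrier G \<Longrightarrow> y \<in> carrier G \<Longrightarrow>
    conj_by G g (x \<otimes> y) = conj_by G g x \<otimes> conj_by G g y"
  by (simp add: conj_by_def m_assoc) (simp flip: m_assoc)

lemma group_hom_conj_by: "g \<in> carrier G \<Longrightarrow> group_hom G G (conj_by G g)"
  by unfold_locales (auto simp: hom_def conj_by_mult)

lemma conj_by_conj_by:
  "g \<in> carrier G \<Longrightarrow> h \<in> carrier G \<Longrightarrow> x \<in> carrier G \<Longrightarrow>
    conj_by G g (conj_by G h x) = conj_by G (g \<otimes> h) x"
  by (simp add: conj_by_def m_assoc inv_mult_group)

lemma conj_by_one [simp]: "x \<in> carrier G \<Longrightarrow> conj_by G \<one> x = x"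
  by (simp add: conj_by_def)

lemma conj_by_inv [simp]:
  "g \<in> carrier G \<Longrightarrow> x \<in> carrier G \<Longrightarrow> conj_by G (inv g) (conj_by G g x) = x"
  "g \<in> carrier G \<Longrightarrow> x \<in> carrier G \<Longrightarrow> conj_by G g (conj_by G (inv g) x) = x"
  by (simp_all add: conj_by_conj_by)

lemma conj_by_eq_iff_commute:
  assumes "g \<in> carrier G" "x \<in> carrier G"
  shows "conj_by G g x = x \<longleftrightarrow> g \<otimes> x = x \<otimes> g"
  using assms by (metis conj_by_def inv_closed inv_solve_right m_closed)

lemma conj_by_nat_pow:
  "g \<in> carrier G \<Longrightarrow> x \<in> carrier G \<Longrightarrow> conj_by G g (x [^] (k::nat)) = conj_by G g x [^] k"
  by (rule group_hom.hom_nat_pow[OF group_hom_conj_by])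

lemma conj_by_funpow:
  assumes "g \<in> carrier G" "x \<in> carrier G"
  shows "(conj_by G g ^^ k) x = conj_by G (g [^] k) x"
proof (induction k)
  case (Suc k)
  then show ?case
    using assms by (simp only: funpow.simps comp_apply conj_by_conj_by nat_pow_closed nat_pow_Suc2)
qed (simp add: assms)

lemma inj_on_conj_by: "g \<in> carrier G \<Longrightarrow> inj_on (conj_by G g) (carrier G)"
  by (metis conj_by_inv(1) inj_onI)

lemma subgroup_conj_by_image:
  "g \<in> carrier G \<Longrightarrow> subgroup H G \<Longrightarrow> subgroup (conj_by G g ` H) G"
  by (rule group_hom.subgroup_img_is_subgroup[OF group_hom_conj_by])

lemma card_conj_by_image:
  "g \<in> carrier G \<Longrightarrow> subgroup H G \<Longrightarrow> card (conj_by G g ` H) = card H"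
  by (meson card_image inj_on_conj_by inj_on_subset subgroup.subset)

lemma conj_by_image_subset_iff:
  assumes "g \<in> carrier G" "A \<subseteq> carrier G" "B \<subseteq> carrier G"
  shows "conj_by G g ` A \<subseteq> B \<longleftrightarrow> A \<subseteq> conj_by G (inv g) ` B"
proof
  assume L: "conj_by G g ` A \<subseteq> B"
  show "A \<subseteq> conj_by G (inv g) ` B"
  proof
    fix a assume a: "a \<in> A"
    then have "a = conj_by G (inv g) (conj_by G g a)" using assms by auto
    then show "a \<in> conj_by G (inv g) ` B" using L a by blast
  qed
next
  assume R: "A \<subseteq> conj_by G (inv g) ` B"
  show "conj_by G g ` A \<subseteq> B"
  proof
    fix x assume "x \<in> conj_by G g ` A"
    then obtain b where "b \<in> B" "x = conj_by G g (conj_by G (inv g) b)" using R by blast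
    then show "x \<in> B" using assms by auto
  qed
qed

section \<open>Centers and lower central series under conjugation\<close>

lemma center_of_conj_by_image:
  assumes "g \<in> carrier G" "P \<subseteq> carrier G" "z \<in> center_of G P"
  shows "conj_by G g z \<in> center_of G (conj_by G g ` P)"
  using assms by (auto simp: center_of_def conj_by_mult[symmetric] subset_iff)

lemma lcs_subset_carrier: "P \<subseteq> carrier G \<Longrightarrow> lcs G P i \<subseteq> carrier G"
proof (induction i)
  case (Suc i)
  then have "{commutator G x y |x y. x \<in> lcs G P i \<and> y \<in> P} \<subseteq> carrier G"
    by (auto simp: commutator_def subset_iff)
  then show ?case using generate_incl by simp
qed simp

lemma lcs_conj_by_image:
  assumes g: "g \<in> carrier G" and P: "P \<subseteq> carrier G"
  shows "lcs G (conj_by G g ` P) i = conj_by G g ` lcs G P i"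
proof (induction i)
  case (Suc i)
  interpret c: group_hom G G "conj_by G g" by (rule group_hom_conj_by[OF g])
  note L = lcs_subset_carrier[OF P, of i]
  have comm: "conj_by G g (commutator G x y) = commutator G (conj_by G g x) (conj_by G g y)"
    if "x \<in> carrier G" "y \<in> carrier G" for x y
    using that by (simp add: commutator_def)
  let ?C = "{commutator G x y |x y. x \<in> lcs G P i \<and> y \<in> P}"
  have "?C \<subseteq> carrier G" using L P by (auto simp: commutator_def subset_iff)
  then have "conj_by G g ` generate G ?C = generate G (conj_by G g ` ?C)"
    by (rule c.generate_img[symmetric])
  also have "conj_by G g ` ?C =
      {commutator G x y |x y. x \<in> lcs G (conj_by G g ` P) i \<and> y \<in> conj_by G g ` P}"
  proof -
    have "conj_by G g ` ?C = (\<lambda>(x, y). conj_by G g (commutator G x y)) ` (lcs G P i \<times> P)"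
      by fast
    also have "\<dots> = (\<lambda>(x, y). commutator G (conj_by G g x) (conj_by G g y)) ` (lcs G P i \<times> P)"
      using L P by (intro image_cong) (auto simp: comm subset_iff)
    also have "\<dots> = {commutator G x y |x y. x \<in> lcs G (conj_by G g ` P) i \<and> y \<in> conj_by G g ` P}"
      unfolding Suc.IH by fast
    finally show ?thesis .
  qed
  finally show ?case by simp
qed simp

lemma nilpotence_class_le_conj_by_image:
  "g \<in> carrier G \<Longrightarrow> P \<subseteq> carrier G \<Longrightarrow> nilpotence_class_le G P c \<Longrightarrow>
    nilpotence_class_le G (conj_by G g ` P) c"
  by (simp add: nilpotence_class_le_def lcs_conj_by_image group_hom.hom_one[OF group_hom_conj_by])

text \<open>The last term of the lower central series not contained in \<open>R\<close> normalizes \<open>R\<close>.\<close>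

lemma nilpotent_normalizer_grows:
  assumes S: "subgroup S G" and R: "subgroup R G" and RS: "R \<subset> S"
    and nil: "nilpotence_class_le G S c"
  obtains x where "x \<in> S" "x \<notin> R" "conj_by G x ` R \<subseteq> R"
proof -
  have SG: "S \<subseteq> carrier G" and RG: "R \<subseteq> carrier G"
    using S R by (auto dest: subgroup.subset)
  have "lcs G S c \<subseteq> R" using nil R by (simp add: nilpotence_class_le_def subgroup.one_closed)
  moreover have "\<not> lcs G S 0 \<subseteq> R" using RS by auto
  ultimately have "\<exists>k<c. (\<forall>i\<le>k. \<not> lcs G S i \<subseteq> R) \<and> lcs G S (Suc k) \<subseteq> R"
    by (rule ex_least_nat_less)
  then obtain i where i: "\<not> lcs G S i \<subseteq> R" "lcs G S (Suc i) \<subseteq> R"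
    by blast
  have dec: "lcs G S j \<subseteq> S" for j
  proof (induction j)
    case (Suc j)
    have "{commutator G x y |x y. x \<in> lcs G S j \<and> y \<in> S} \<subseteq> S"
      using Suc S by (auto simp: commutator_def subset_iff
          intro!: subgroup.m_closed subgroup.m_inv_closed)
    then show ?case using generate_subgroup_incl[OF _ S] by simp
  qed simp
  obtain x where x: "x \<in> lcs G S i" "x \<notin> R" using i by blast
  then have xS: "x \<in> S" and xG: "x \<in> carrier G" using dec SG by auto
  have "conj_by G x r \<in> R" if r: "r \<in> R" for r
  proof -
    have rG: "r \<in> carrier G" using r RG by auto
    have "commutator G x r \<in> lcs G S (Suc i)"
      using x r RS by (auto intro!: generate.incl)
    then have "commutator G x r \<otimes> r \<in> R" using i r R by (auto intro: subgroup.m_closed)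
    also have "commutator G x r \<otimes> r = conj_by G x r"
      using xG rG by (simp add: commutator_def conj_by_def m_assoc)
    finally show ?thesis .
  qed
  then show thesis using that[of x] xS x by blast
qed

text \<open>Stop one step before the iterated \<open>p\<close>-th powers of \<open>x\<close> first
  enter \<open>R\<close>.\<close>

lemma exists_pth_power_mem:
  assumes R: "subgroup R G" and x: "x \<in> carrier G" "x \<notin> R" and pow: "x [^] (p ^ k :: nat) \<in> R"
  obtains j where "x [^] (p ^ j :: nat) \<notin> R" "(x [^] (p ^ j :: nat)) [^] p \<in> R"
proof -
  have "x [^] (p ^ 0 :: nat) \<notin> R" using x by simp
  then obtain j where "x [^] (p ^ j) \<notin> R" "x [^] (p ^ Suc j) \<in> R"
    using ex_least_nat_less[of "\<lambda>i. x [^] (p ^ i :: nat) \<in> R" k] pow by auto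
  then show thesis using that[of j] x by (simp add: nat_pow_pow mult.commute)
qed

subsection \<open>Sylow subgroups\<close>

text \<open>The inverse of left multiplication by \<open>q\<close> is left multiplication by
  \<open>inv q\<close>. The maps are restricted to \<open>lcosets S\<close> because the elements of
  \<open>BijGroup\<close> are extensional functions.\<close>

lemma lcoset_action:
  assumes Q: "subgroup Q G" and S: "subgroup S G"
  shows "group_action (G\<lparr>carrier := Q\<rparr>) (lcosets S) (\<lambda>q. \<lambda>U\<in>lcosets S. q <# U)"
    (is "group_action _ ?E ?f")
proof -
  have SG: "S \<subseteq> carrier G" and QG: "Q \<subseteq> carrier G" using S Q by (auto dest: subgroup.subset)
  have Esub: "U \<subseteq> carrier G" if "U \<in> ?E" for U
    using that S by (meson is_group subgroup.lcosets_carrier)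
  have Ecl: "q <# U \<in> ?E" if "q \<in> carrier G" "U \<in> ?E" for q U
    using that SG by (auto simp: LCOSETS_def lcos_m_assoc)
  have fB: "?f q \<in> Bij ?E" if q: "q \<in> carrier G" for q
  proof -
    have "bij_betw (\<lambda>U. q <# U) ?E ?E"
      by (rule bij_betw_byWitness[where f' = "\<lambda>U. inv q <# U"])
         (simp_all add: q Ecl Esub lcos_m_assoc lcos_mult_one image_subset_iff)
    then have "bij_betw (?f q) ?E ?E"
      by (rule bij_betw_cong[THEN iffD1, rotated]) simp
    then show ?thesis by (simp add: Bij_def)
  qed
  have fmult: "?f (q \<otimes> r) = compose ?E (?f q) (?f r)" if "q \<in> carrier G" "r \<in> carrier G" for q r
    unfolding compose_def
    by (rule restrict_ext) (simp add: that Ecl Esub lcos_m_assoc)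
  have "?f \<in> hom (G\<lparr>carrier := Q\<rparr>) (BijGroup ?E)"
    unfolding hom_def BijGroup_def using QG fB by (simp add: fmult Pi_iff subset_iff)
  then show ?thesis
    using Q by (simp add: group_action_def group_hom_def group_hom_axioms_def group_BijGroup
        subgroup.subgroup_is_group is_group)
qed

text \<open>The orbits of \<open>Q\<close> on the left cosets of \<open>S\<close> have
  \<open>p\<close>-power size, and their sizes add up to a number prime to \<open>p\<close>, so some
  coset \<open>g <# S\<close> is fixed. Then \<open>q \<otimes> g\<close> lies in
  \<open>g <# S\<close> for all \<open>q\<close> in \<open>Q\<close>, and conjugation by
  \<open>inv g\<close> maps \<open>Q\<close> into \<open>S\<close>.\<close>

lemma p_subgroup_conj_into:
  assumes p: "Factorial_Ring.prime p" and fin: "finite (carrier G)"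
    and Q: "subgroup Q G" and cQ: "card Q = p ^ k"
    and S: "subgroup S G" and ndvd: "\<not> p dvd card (lcosets S)"
  shows "\<exists>g\<in>carrier G. conj_by G g ` Q \<subseteq> S"
proof -
  let ?E = "lcosets S" and ?f = "\<lambda>q. \<lambda>U\<in>lcosets S. q <# U" and ?Q = "G\<lparr>carrier := Q\<rparr>"
  interpret act: group_action ?Q ?E ?f by (rule lcoset_action[OF Q S])
  have SG: "S \<subseteq> carrier G" and QG: "Q \<subseteq> carrier G" using S Q by (auto dest: subgroup.subset)
  have finE: "finite ?E" using fin by (simp add: LCOSETS_def)
  have "\<not> (\<forall>B\<in>orbits ?Q ?E ?f. p dvd card B)"
  proof
    assume "\<forall>B\<in>orbits ?Q ?E ?f. p dvd card B"
    then have "p dvd card (\<Union> (orbits ?Q ?E ?f))"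
      using act.disjoint_union finE act.orbits_coverture by (intro dvd_partition) auto
    then show False using ndvd act.orbits_coverture by simp
  qed
  then obtain U where U: "U \<in> ?E" "\<not> p dvd card (orbit ?Q ?f U)"
    by (auto simp: orbits_def)
  have "card (orbit ?Q ?f U) * card (stabilizer ?Q ?f U) = p ^ k"
    using act.orbit_stabilizer_theorem[OF U(1)] cQ by (simp add: Coset.order_def del: mult_eq_1_iff)
  then have "card (orbit ?Q ?f U) dvd p ^ k" by (rule dvdI[OF sym])
  then obtain i where i: "card (orbit ?Q ?f U) = p ^ i"
    using divides_primepow_nat[OF p] by blast
  then have "card (orbit ?Q ?f U) = 1" using U(2) by (cases i) auto
  then have orb: "orbit ?Q ?f U = {U}"
    using act.orbit_refl[OF U(1)] by (metis card_1_singletonE singletonD)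
  have fixed: "q <# U = U" if "q \<in> Q" for q
  proof -
    have "?f q U \<in> orbit ?Q ?f U" using that by (auto simp: orbit_def)
    then show ?thesis using orb U(1) by simp
  qed
  obtain g where g: "g \<in> carrier G" "U = g <# S" using U(1) by (auto simp: LCOSETS_def)
  have "conj_by G (inv g) q \<in> S" if q: "q \<in> Q" for q
  proof -
    have qG: "q \<in> carrier G" using q QG by auto
    have "g \<in> U" using g S by (simp add: lcos_self)
    then have "q \<otimes> g \<in> U" using fixed[OF q] by (force simp: l_coset_def)
    then have "inv g \<otimes> (q \<otimes> g) \<in> S"
      using subgroup.lcos_module_imp[OF S is_group g(1)] g(2) by simp
    then show ?thesis using g qG by (simp add: conj_by_def m_assoc)
  qed
  then show ?thesis using g(1) by (intro bexI[of _ "inv g"]) auto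
qed

lemma sylow_subgroup_exists:
  assumes p: "Factorial_Ring.prime p" and fin: "finite (carrier G)"
  obtains S where "sylow_subgroup G p S"
proof -
  obtain m where "Coset.order G = p ^ multiplicity p (Coset.order G) * m"
    using multiplicity_dvd[of p "Coset.order G"] by (elim dvdE)
  from sylow_thm[OF p is_group this fin] that show thesis by (auto simp: sylow_subgroup_def)
qed

lemma not_dvd_card_lcosets_sylow:
  assumes p: "Factorial_Ring.prime p" and fin: "finite (carrier G)" and S: "sylow_subgroup G p S"
  shows "\<not> p dvd card (lcosets S)"
proof
  assume "p dvd card (lcosets S)"
  then have "p * card S dvd Coset.order G"
    using l_lagrange[OF fin] S by (metis mult_dvd_mono dvd_refl sylow_subgroup_def)
  then have "p ^ Suc (multiplicity p (Coset.order G)) dvd Coset.order G"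
    using S by (simp add: sylow_subgroup_def)
  moreover have "Coset.order G \<noteq> 0" using fin by (metis order_gt_0_iff_finite less_numeral_extra(3))
  moreover have "\<not> is_unit p" using p not_prime_unit by blast
  ultimately have "Suc (multiplicity p (Coset.order G)) \<le> multiplicity p (Coset.order G)"
    by (intro multiplicity_geI)
  then show False by simp
qed

lemma card_p_subgroup_le_sylow:
  assumes p: "Factorial_Ring.prime p" and fin: "finite (carrier G)" and S: "sylow_subgroup G p S"
    and Q: "subgroup Q G" and cQ: "card Q = p ^ k"
  shows "card Q \<le> card S"
proof -
  have "p ^ k dvd Coset.order G" using lagrange[OF Q] cQ by (metis dvd_triv_right)
  moreover have "Coset.order G \<noteq> 0" using fin by (metis order_gt_0_iff_finite less_numeral_extra(3))
  moreover have "\<not> is_unit p" using p not_prime_unit by blast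
  ultimately have "k \<le> multiplicity p (Coset.order G)" by (intro multiplicity_geI)
  then have "p ^ k \<le> p ^ multiplicity p (Coset.order G)"
    using p by (intro power_increasing) (auto dest: prime_ge_1_nat)
  then show ?thesis using S cQ by (simp add: sylow_subgroup_def)
qed

lemma sylow_subgroup_conj_by_image:
  "g \<in> carrier G \<Longrightarrow> sylow_subgroup G p S \<Longrightarrow> sylow_subgroup G p (conj_by G g ` S)"
  by (simp add: sylow_subgroup_def subgroup_conj_by_image card_conj_by_image)

text \<open>Sylow's theorem inside \<open>M\<close>, carried back to \<open>G\<close>: the inverses
  of the restricted structure agree with those of \<open>G\<close> on \<open>M\<close>, hence so do
  the conjugations.\<close>

lemma sylow_of_subgroup:
  assumes p: "Factorial_Ring.prime p" and fin: "finite (carrier G)" and M: "subgroup M G"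
  obtains U a where "subgroup U G" "U \<subseteq> M" "card U = p ^ a"
    "\<And>Q k. subgroup Q G \<Longrightarrow> Q \<subseteq> M \<Longrightarrow> card Q = p ^ k \<Longrightarrow> \<exists>m\<in>M. conj_by G m ` Q \<subseteq> U"
proof -
  let ?M = "G\<lparr>carrier := M\<rparr>"
  interpret M: group ?M by (rule subgroup.subgroup_is_group[OF M is_group])
  have finM: "finite (carrier ?M)" using M fin by (auto dest: subgroup.subset intro: finite_subset)
  obtain U where U: "sylow_subgroup ?M p U" using M.sylow_subgroup_exists[OF p finM] .
  then have XM: "subgroup U ?M" by (simp add: sylow_subgroup_def)
  show thesis
  proof (rule that)
    show "subgroup U G" by (rule incl_subgroup[OF M XM])
    show "U \<subseteq> M" using subgroup.subset[OF XM] by simp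
    show "card U = p ^ multiplicity p (Coset.order ?M)" using U by (simp add: sylow_subgroup_def)
    fix Q k assume Q: "subgroup Q G" "Q \<subseteq> M" "card Q = p ^ k"
    have "subgroup Q ?M" using Q M by (simp add: subgroup_incl)
    from M.p_subgroup_conj_into[OF p finM this Q(3) XM M.not_dvd_card_lcosets_sylow[OF p finM U]]
    obtain m where m: "m \<in> M" "conj_by ?M m ` Q \<subseteq> U" by auto
    moreover have "conj_by ?M m = conj_by G m"
      using m M by (simp add: conj_by_def fun_eq_iff m_inv_consistent)
    ultimately show "\<exists>m\<in>M. conj_by G m ` Q \<subseteq> U" by auto
  qed
qed

lemma p_subgroup_subset_conj_sylow:
  assumes p: "Factorial_Ring.prime p" and fin: "finite (carrier G)" and M: "subgroup M G"
    and T: "sylow_subgroup G p T" "T \<subseteq> M"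
    and Q: "subgroup Q G" "Q \<subseteq> M" "card Q = p ^ k"
  obtains m where "m \<in> M" "Q \<subseteq> conj_by G m ` T"
proof -
  obtain U a where U: "subgroup U G" "U \<subseteq> M" "card U = p ^ a" and
    conj: "\<And>Q k. subgroup Q G \<Longrightarrow> Q \<subseteq> M \<Longrightarrow> card Q = p ^ k \<Longrightarrow> \<exists>m\<in>M. conj_by G m ` Q \<subseteq> U"
    using sylow_of_subgroup[OF p fin M] by blast
  have MG: "M \<subseteq> carrier G" and XG: "U \<subseteq> carrier G" using M U by (auto dest: subgroup.subset)
  obtain r where r: "r \<in> M" "conj_by G r ` Q \<subseteq> U" using conj[OF Q] by blast
  obtain t where t: "t \<in> M" "conj_by G t ` T \<subseteq> U"
    using conj[of T] T unfolding sylow_subgroup_def by blast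
  have rG: "r \<in> carrier G" and tG: "t \<in> carrier G" using r t MG by auto
  \<comment> \<open>\<open>U\<close> is a \<open>p\<close>-subgroup of \<open>G\<close>, so it is no
    larger than the Sylow subgroup \<open>T\<close>, whose conjugate it contains.\<close>
  have "conj_by G t ` T = U"
  proof (rule card_seteq)
    show "finite U" using XG fin by (rule finite_subset)
    show "card U \<le> card (conj_by G t ` T)"
      using card_p_subgroup_le_sylow[OF p fin T(1) U(1,3)] T tG
      by (simp add: card_conj_by_image sylow_subgroup_def)
  qed (rule t)
  moreover have QG: "Q \<subseteq> carrier G" and TG: "T \<subseteq> carrier G" using Q(2) T(2) MG by auto
  ultimately have "Q \<subseteq> conj_by G (inv r) ` conj_by G t ` T"
    using conj_by_image_subset_iff[OF rG QG XG] r(2) by simp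
  also have "\<dots> = conj_by G (inv r \<otimes> t) ` T"
    using TG rG tG by (auto simp: image_image conj_by_conj_by subset_iff intro!: image_cong)
  finally show thesis
    using that[of "inv r \<otimes> t"] M r t by (simp add: subgroup.m_closed subgroup.m_inv_closed)
qed

text \<open>Equal orders turn the inclusion into a conjugate into equality. The point is that the
  conjugating element lies in \<open>M\<close>, which will be the centralizer of an element or all
  of \<open>G\<close>.\<close>

lemma sylow_subgroups_conj:
  assumes p: "Factorial_Ring.prime p" and fin: "finite (carrier G)" and M: "subgroup M G"
    and T: "sylow_subgroup G p T" "T \<subseteq> M" and S: "sylow_subgroup G p S" "S \<subseteq> M"
  obtains m where "m \<in> M" "S = conj_by G m ` T"
proof -
  obtain m where m: "m \<in> M" "S \<subseteq> conj_by G m ` T"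
    using p_subgroup_subset_conj_sylow[OF p fin M T _ S(2)] S(1)
    unfolding sylow_subgroup_def by blast
  have mG: "m \<in> carrier G" using m M by (auto dest: subgroup.subset)
  have "S = conj_by G m ` T"
  proof (rule card_seteq)
    show "finite (conj_by G m ` T)"
      using T fin M by (meson finite_imageI finite_subset subgroup.subset)
    show "card (conj_by G m ` T) \<le> card S"
      using S T mG by (simp add: card_conj_by_image sylow_subgroup_def)
  qed (rule m)
  with m(1) show thesis by (rule that)
qed

subsection \<open>Centralizers, normalizers and centers\<close>

lemma subgroup_element_centralizer:
  assumes b: "b \<in> carrier G"
  shows "subgroup {g \<in> carrier G. conj_by G g b = b} G"
proof (rule subgroupI)
  fix g assume "g \<in> {g \<in> carrier G. conj_by G g b = b}"
  then show "inv g \<in> {g \<in> carrier G. conj_by G g b = b}"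
    using conj_by_inv(1)[of g b] b by auto
next
  fix g h assume "g \<in> {g \<in> carrier G. conj_by G g b = b}" "h \<in> {g \<in> carrier G. conj_by G g b = b}"
  then show "g \<otimes> h \<in> {g \<in> carrier G. conj_by G g b = b}"
    using b by (auto simp flip: conj_by_conj_by)
qed (use b in auto)

lemma subgroup_set_normalizer:
  assumes R: "R \<subseteq> carrier G"
  shows "subgroup {g \<in> carrier G. conj_by G g ` R = R} G"
proof (rule subgroupI)
  fix g assume g: "g \<in> {g \<in> carrier G. conj_by G g ` R = R}"
  then have "conj_by G (inv g) ` R = conj_by G (inv g) ` (conj_by G g ` R)" by simp
  also have "\<dots> = (\<lambda>x. conj_by G (inv g) (conj_by G g x)) ` R" by (rule image_image)
  also have "\<dots> = (\<lambda>x. x) ` R" using g R by (intro image_cong) auto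
  finally show "inv g \<in> {g \<in> carrier G. conj_by G g ` R = R}" using g by simp
next
  fix g h
  assume gh: "g \<in> {g \<in> carrier G. conj_by G g ` R = R}" "h \<in> {g \<in> carrier G. conj_by G g ` R = R}"
  have "conj_by G (g \<otimes> h) ` R = conj_by G g ` (conj_by G h ` R)"
    unfolding image_image using gh R by (intro image_cong) (auto simp: conj_by_conj_by)
  then show "g \<otimes> h \<in> {g \<in> carrier G. conj_by G g ` R = R}" using gh by simp
qed (use R in \<open>auto intro!: exI[of _ \<one>] simp: image_iff subset_iff\<close>)

section \<open>Orders and iterated commutators in a Sylow subgroup\<close>

lemma card_subgroup_of_p_subgroup:
  assumes p: "Factorial_Ring.prime p" and S: "subgroup S G" "card S = p ^ a"
    and Q: "subgroup Q G" "Q \<subseteq> S"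
  obtains k where "card Q = p ^ k"
proof -
  interpret S: group "G\<lparr>carrier := S\<rparr>" using S(1) by (rule subgroup.subgroup_is_group) (rule is_group)
  have "card Q dvd p ^ a"
    using S.lagrange[OF subgroup_incl[OF Q(1) S(1) Q(2)]] S(2)
    by (simp add: Coset.order_def) (metis dvd_triv_right)
  then show thesis using divides_primepow_nat[OF p] that by blast
qed

lemma pow_card_subgroup_eq_one:
  assumes "finite (carrier G)" "subgroup S G" "x \<in> S"
  shows "x [^] card S = \<one>"
proof -
  interpret S: group "G\<lparr>carrier := S\<rparr>"
    using assms(2) by (rule subgroup.subgroup_is_group) (rule is_group)
  show ?thesis
    using S.pow_order_eq_1[of x] assms
    by (simp add: Coset.order_def nat_pow_consistent[symmetric])
qed

text \<open>\<open>u \<otimes> inv (conj_by G x u)\<close> is the commutator of \<open>u\<close> and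
  \<open>x\<close>, so each application descends one term of the series, starting from
  \<open>lcs G S 0 = S\<close>.\<close>

lemma iterated_commutator_in_lcs:
  assumes S: "S \<subseteq> carrier G" and x: "x \<in> S" and y: "y \<in> S"
  shows "((\<lambda>u. u \<otimes> inv (conj_by G x u)) ^^ k) y \<in> lcs G S k"
proof (induction k)
  case (Suc k)
  let ?u = "((\<lambda>u. u \<otimes> inv (conj_by G x u)) ^^ k) y"
  have G: "?u \<in> carrier G" "x \<in> carrier G" using Suc lcs_subset_carrier[OF S] S x by auto
  then have "?u \<otimes> inv (conj_by G x ?u) = commutator G ?u x"
    by (simp add: conj_by_def commutator_def inv_mult_group m_assoc)
  then show ?case using Suc x by (auto intro!: generate.incl)
qed (use y in simp)

lemma center_of_mem: "a \<in> center_of G R \<Longrightarrow> a \<in> R"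
  and center_of_comm: "a \<in> center_of G R \<Longrightarrow> r \<in> R \<Longrightarrow> a \<otimes> r = r \<otimes> a"
  and center_ofI: "a \<in> R \<Longrightarrow> (\<And>r. r \<in> R \<Longrightarrow> a \<otimes> r = r \<otimes> a) \<Longrightarrow> a \<in> center_of G R"
  unfolding center_of_def by blast+

lemma subgroup_center_of:
  assumes R: "subgroup R G"
  shows "subgroup (center_of G R) G"
proof -
  have RG: "R \<subseteq> carrier G" using R by (rule subgroup.subset)
  show ?thesis
  proof (rule subgroupI)
    fix a assume a: "a \<in> center_of G R"
    then have aG [simp]: "a \<in> carrier G" using RG center_of_mem by blast
    have "inv a \<otimes> r = r \<otimes> inv a" if "r \<in> R" for r
    proof -
      have [simp]: "r \<in> carrier G" using that RG by auto
      have "inv a \<otimes> r = inv a \<otimes> (r \<otimes> a) \<otimes> inv a" by (simp add: m_assoc)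
      also have "r \<otimes> a = a \<otimes> r" by (rule center_of_comm[OF a that, symmetric])
      also have "inv a \<otimes> (a \<otimes> r) \<otimes> inv a = r \<otimes> inv a" by (simp flip: m_assoc)
      finally show ?thesis .
    qed
    moreover have "inv a \<in> R" by (rule subgroup.m_inv_closed[OF R center_of_mem[OF a]])
    ultimately show "inv a \<in> center_of G R" by (intro center_ofI)
  next
    fix a b assume ab: "a \<in> center_of G R" "b \<in> center_of G R"
    then have [simp]: "a \<in> carrier G" "b \<in> carrier G" using RG center_of_mem by blast+
    have "a \<otimes> b \<otimes> r = r \<otimes> (a \<otimes> b)" if "r \<in> R" for r
    proof -
      have [simp]: "r \<in> carrier G" using that RG by auto
      have "a \<otimes> b \<otimes> r = a \<otimes> (b \<otimes> r)" by (simp add: m_assoc)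
      also have "b \<otimes> r = r \<otimes> b" by (rule center_of_comm[OF ab(2) that])
      also have "a \<otimes> (r \<otimes> b) = a \<otimes> r \<otimes> b" by (simp add: m_assoc)
      also have "a \<otimes> r = r \<otimes> a" by (rule center_of_comm[OF ab(1) that])
      finally show ?thesis by (simp add: m_assoc)
    qed
    moreover have "a \<otimes> b \<in> R" by (rule subgroup.m_closed[OF R ab[THEN center_of_mem]])
    ultimately show "a \<otimes> b \<in> center_of G R" by (intro center_ofI)
  next
    have "\<one> \<in> center_of G R"
      using RG by (intro center_ofI) (auto simp: subgroup.one_closed[OF R] subset_iff)
    then show "center_of G R \<noteq> {}" by blast
  qed (use RG center_of_mem in blast)
qed

text \<open>Conjugation by \<open>x\<close> acts on the abelian group \<open>Z(R)\<close> because
  \<open>x\<close> normalizes \<open>R\<close>. Its \<open>p\<close>-th iterate fixes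
  \<open>y\<close> since \<open>x [^] p\<close> lies in \<open>R\<close>, and the class bound kills
  the iterated commutators of \<open>y\<close> with \<open>x\<close>;
  \<open>endo_fixes_prime_power\<close> then applies.\<close>

lemma prime_power_centralized:
  assumes p: "Factorial_Ring.prime p" and S: "subgroup S G" and R: "subgroup R G" "R \<subseteq> S"
    and nil: "nilpotence_class_le G S (n * (p - 1) + 1)"
    and x: "x \<in> S" "conj_by G x ` R = R" "x [^] p \<in> R"
    and y: "y \<in> center_of G R"
  shows "conj_by G x (y [^] (p ^ n)) = y [^] (p ^ n)"
proof -
  let ?Z = "center_of G R" and ?\<sigma> = "conj_by G x"
  have SG: "S \<subseteq> carrier G" and RG: "R \<subseteq> carrier G" and xG: "x \<in> carrier G"
    using S R x by (auto dest: subgroup.subset)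
  have Z: "subgroup ?Z G" by (rule subgroup_center_of[OF R(1)])
  interpret Z: group "G\<lparr>carrier := ?Z\<rparr>" using Z by (rule subgroup.subgroup_is_group) (rule is_group)
  interpret Z: comm_group "G\<lparr>carrier := ?Z\<rparr>"
    by (rule Z.group_comm_groupI) (simp add: center_of_comm center_of_mem)
  have hom: "?\<sigma> \<in> hom (G\<lparr>carrier := ?Z\<rparr>) (G\<lparr>carrier := ?Z\<rparr>)"
  proof -
    have "?\<sigma> u \<in> ?Z" if "u \<in> ?Z" for u
      using center_of_conj_by_image[OF xG RG that] x(2) by simp
    moreover have "?Z \<subseteq> carrier G" using RG center_of_mem by blast
    ultimately show ?thesis by (simp add: hom_def conj_by_mult xG subset_iff)
  qed
  have yR: "y \<in> R" and yG: "y \<in> carrier G" using y RG center_of_mem by blast+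
  have inv_eq: "inv\<^bsub>G\<lparr>carrier := ?Z\<rparr>\<^esub> u = inv u" if "u \<in> ?Z" for u
    using that Z by (simp add: m_inv_consistent)
  have \<sigma>Z: "?\<sigma> u \<in> ?Z" if "u \<in> ?Z" for u using hom that by (auto simp: hom_def)
  \<comment> \<open>Inverses in the restricted structure are known to agree with those of
    \<open>G\<close> only on \<open>Z(R)\<close>, so the induction carries membership along.\<close>
  have iter: "((\<lambda>u. u \<otimes> inv\<^bsub>G\<lparr>carrier := ?Z\<rparr>\<^esub> (?\<sigma> u)) ^^ k) y
      = ((\<lambda>u. u \<otimes> inv (?\<sigma> u)) ^^ k) y \<and> ((\<lambda>u. u \<otimes> inv (?\<sigma> u)) ^^ k) y \<in> ?Z" for k
    by (induction k) (auto simp: y inv_eq \<sigma>Z subgroup.m_closed[OF Z] subgroup.m_inv_closed[OF Z])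
  have "((\<lambda>u. u \<otimes> inv (?\<sigma> u)) ^^ (n * (p - 1) + 1)) y \<in> lcs G S (n * (p - 1) + 1)"
    using yR R(2) by (intro iterated_commutator_in_lcs SG x) auto
  then have unip: "((\<lambda>u. u \<otimes>\<^bsub>G\<lparr>carrier := ?Z\<rparr>\<^esub> inv\<^bsub>G\<lparr>carrier := ?Z\<rparr>\<^esub> (?\<sigma> u)) ^^ (n * (p - 1) + 1)) y
      = \<one>\<^bsub>G\<lparr>carrier := ?Z\<rparr>\<^esub>"
    using nil iter[of "n * (p - 1) + 1"] by (simp add: nilpotence_class_le_def)
  have "conj_by G (x [^] p) y = y"
    using xG yG center_of_comm[OF y x(3)] by (subst conj_by_eq_iff_commute) simp_all
  then have per: "(?\<sigma> ^^ p) y = y" using xG yG by (simp add: conj_by_funpow)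
  have "?\<sigma> (y [^]\<^bsub>G\<lparr>carrier := ?Z\<rparr>\<^esub> (p ^ n)) = y [^]\<^bsub>G\<lparr>carrier := ?Z\<rparr>\<^esub> (p ^ n)"
    using Z.endo_fixes_prime_power[OF hom _ p per unip] y by simp
  then show ?thesis by (simp add: nat_pow_consistent[symmetric])
qed

section \<open>Powers of central elements\<close>

lemma central_power_subset_center:
  assumes "subgroup S G"
  shows "central_power G S q \<subseteq> center_of G S"
proof
  fix b assume "b \<in> central_power G S q"
  then obtain z where z: "z \<in> center_of G S" "b = z [^] q" by (auto simp: central_power_def)
  have SG: "S \<subseteq> carrier G" using assms by (rule subgroup.subset)
  have comm: "z [^] q \<otimes> x = x \<otimes> z [^] q" if "x \<in> S" for x
    using z that SG by (intro group_commutes_pow) (unfold center_of_def, blast+)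
  have zS: "z \<in> S" using z unfolding center_of_def by blast
  have "z [^] q \<in> S"
    by (induction q) (simp_all add: zS subgroup.one_closed[OF assms] subgroup.m_closed[OF assms])
  then show "b \<in> center_of G S" using z(2) comm unfolding center_of_def by blast
qed

lemma central_power_conj_by_image:
  assumes g: "g \<in> carrier G" and S: "S \<subseteq> carrier G" and b: "b \<in> central_power G S q"
  shows "conj_by G g b \<in> central_power G (conj_by G g ` S) q"
proof -
  obtain z where z: "z \<in> center_of G S" "b = z [^] q" using b by (auto simp: central_power_def)
  moreover have "z \<in> carrier G" using z S by (auto simp: center_of_def)
  ultimately show ?thesis
    using center_of_conj_by_image[OF g S z(1)] g by (auto simp: central_power_def conj_by_nat_pow)
qed

subsection \<open>Fusion of central powers\<close>

lemma central_power_commute: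
  assumes S: "subgroup S G" and b: "b \<in> central_power G S q" and x: "x \<in> S"
  shows "conj_by G x b = b"
proof -
  have bZ: "b \<in> center_of G S" using central_power_subset_center[OF S] b by blast
  have "S \<subseteq> carrier G" using S by (rule subgroup.subset)
  then have "x \<in> carrier G" "b \<in> carrier G" using x center_of_mem[OF bZ] by auto
  then show ?thesis using center_of_comm[OF bZ x] by (subst conj_by_eq_iff_commute) simp_all
qed

lemma center_of_conj_by:
  assumes S: "subgroup S G" and b: "b \<in> S" and x: "\<And>x. x \<in> S \<Longrightarrow> conj_by G x b = b"
  shows "b \<in> center_of G S"
proof (rule center_ofI[OF b])
  fix r assume r: "r \<in> S"
  have "S \<subseteq> carrier G" using S by (rule subgroup.subset)
  then have "r \<in> carrier G" "b \<in> carrier G" using b r by auto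
  then show "b \<otimes> r = r \<otimes> b" using x[OF r] by (subst (asm) conj_by_eq_iff_commute) simp_all
qed

text \<open>Both \<open>S\<close> and \<open>T\<close> lie in the centralizer of \<open>b\<close>,
  hence are conjugate by an element fixing \<open>b\<close>. This conjugation carries a
  \<open>q\<close>-th root of \<open>b\<close> in \<open>Z(T)\<close> to one in
  \<open>Z(S)\<close>.\<close>

lemma central_power_sylow_transfer:
  assumes p: "Factorial_Ring.prime p" and fin: "finite (carrier G)"
    and S: "sylow_subgroup G p S" and T: "sylow_subgroup G p T"
    and bT: "b \<in> central_power G T q" and bS: "b \<in> center_of G S"
  shows "b \<in> central_power G S q"
proof -
  have sS: "subgroup S G" and sT: "subgroup T G" using S T by (simp_all add: sylow_subgroup_def)
  have SG: "S \<subseteq> carrier G" and TG: "T \<subseteq> carrier G"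
    using sS sT by (simp_all add: subgroup.subset)
  have bG: "b \<in> carrier G" using center_of_mem[OF bS] SG by auto
  let ?C = "{g \<in> carrier G. conj_by G g b = b}"
  have "T \<subseteq> ?C" using TG central_power_commute[OF sT bT] by auto
  moreover have "S \<subseteq> ?C"
  proof
    fix x assume x: "x \<in> S"
    then have "x \<in> carrier G" using SG by auto
    with center_of_comm[OF bS x] bG show "x \<in> ?C" by (simp add: conj_by_eq_iff_commute)
  qed
  ultimately obtain m where m: "m \<in> ?C" "S = conj_by G m ` T"
    using sylow_subgroups_conj[OF p fin subgroup_element_centralizer[OF bG] T _ S] by blast
  then have "conj_by G m b \<in> central_power G S q"
    using central_power_conj_by_image[OF _ TG bT, of m] by simp
  then show ?thesis using m by simp
qed

text \<open>A normalizing element outside \<open>R\<close> exists by nilpotency, and finiteness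
  makes its conjugate of \<open>R\<close> equal to \<open>R\<close>. As its order is a power of
  \<open>p\<close>, one of its \<open>p\<close>-power powers is the last outside
  \<open>R\<close>.\<close>

lemma normalizer_p_subgroup_grows:
  assumes p: "Factorial_Ring.prime p" and fin: "finite (carrier G)"
    and S: "subgroup S G" "card S = p ^ a" and R: "subgroup R G" and RS: "R \<subset> S"
    and nil: "nilpotence_class_le G S c"
  obtains x where "x \<in> S" "x \<notin> R" "conj_by G x ` R = R" "x [^] p \<in> R"
proof -
  have SG: "S \<subseteq> carrier G" and RG: "R \<subseteq> carrier G"
    using S R by (simp_all add: subgroup.subset)
  obtain u where u: "u \<in> S" "u \<notin> R" "conj_by G u ` R \<subseteq> R"
    using nilpotent_normalizer_grows[OF S(1) R RS nil] .
  let ?N = "{g \<in> carrier G. conj_by G g ` R = R}"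
  have uG: "u \<in> carrier G" using u SG by auto
  have "conj_by G u ` R = R"
    using u(3) by (intro card_subset_eq) (auto simp: card_conj_by_image uG R intro: finite_subset[OF RG fin])
  then have "u \<in> S \<inter> ?N" using u uG by simp
  moreover have SN: "subgroup (S \<inter> ?N) G"
    using S(1) subgroup_set_normalizer[OF RG] by (rule subgroups_Inter_pair)
  ultimately have pow: "u [^] k \<in> S \<inter> ?N" for k :: nat
    by (induction k) (simp_all only: nat_pow_0 nat_pow_Suc subgroup.one_closed subgroup.m_closed)
  have "u [^] (p ^ a) = \<one>" using pow_card_subgroup_eq_one[OF fin S(1) u(1)] S(2) by simp
  then have "u [^] (p ^ a) \<in> R" using R by (simp add: subgroup.one_closed)
  then obtain j where j: "u [^] (p ^ j) \<notin> R" "(u [^] (p ^ j)) [^] p \<in> R"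
    using exists_pth_power_mem[OF R uG u(2)] by blast
  show thesis using that[of "u [^] (p ^ j)"] j pow[of "p ^ j"] by blast
qed

lemma sylow_class_le:
  assumes p: "Factorial_Ring.prime p" and fin: "finite (carrier G)"
    and P: "sylow_subgroup G p P" "nilpotence_class_le G P c" and S: "sylow_subgroup G p S"
  shows "nilpotence_class_le G S c"
proof -
  have PG: "P \<subseteq> carrier G" and SG: "S \<subseteq> carrier G"
    using P S by (simp_all add: sylow_subgroup_def subgroup.subset)
  obtain m where "m \<in> carrier G" "S = conj_by G m ` P"
    using sylow_subgroups_conj[OF p fin subgroup_self P(1) PG S SG] .
  then show ?thesis using nilpotence_class_le_conj_by_image PG P(2) by simp
qed

text \<open>The class bound is assumed for every Sylow subgroup because the counterexample with
  maximal intersection may involve others than \<open>S0\<close> and \<open>T0\<close>.\<close>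

lemma central_power_in_center_of_sylow:
  assumes p: "Factorial_Ring.prime p" and fin: "finite (carrier G)"
    and nil: "\<And>S. sylow_subgroup G p S \<Longrightarrow> nilpotence_class_le G S (n * (p - 1) + 1)"
    and S0: "sylow_subgroup G p S0" and T0: "sylow_subgroup G p T0"
    and b0: "b0 \<in> S0" "b0 \<in> central_power G T0 (p ^ n)"
  shows "b0 \<in> center_of G S0"
proof (rule ccontr)
  assume b0_not: "b0 \<notin> center_of G S0"
  define q where "q = p ^ n"
  \<comment> \<open>The element \<open>b\<close> is part of the triple, since maximality is later
    applied to a conjugate of \<open>b\<close> as well.\<close>
  define bad where "bad = (\<lambda>(S, T, b). sylow_subgroup G p S \<and> sylow_subgroup G p T \<and>
    b \<in> S \<and> b \<in> central_power G T q \<and> b \<notin> center_of G S)"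
  have sub: "subgroup S G" "S \<subseteq> carrier G" "finite S" "card S = p ^ multiplicity p (Coset.order G)"
    if "sylow_subgroup G p S" for S
    using that fin by (auto simp: sylow_subgroup_def subgroup.subset intro: finite_subset dest: subgroup.subset)
  have cp: "b \<in> T" if "sylow_subgroup G p T" "b \<in> central_power G T q" for T b
    using that central_power_subset_center[OF sub(1)] center_of_mem by blast
  define overlap where "overlap = (\<lambda>(S, T, b :: 'a). card (S \<inter> T :: 'a set))"
  have "bad (S0, T0, b0)" using assms b0_not by (simp add: bad_def q_def)
  moreover have "\<forall>w. bad w \<longrightarrow> overlap w < Suc (card (carrier G))"
    using fin sub(2) by (auto simp: bad_def overlap_def less_Suc_eq_le intro!: card_mono)
  ultimately have "\<exists>w. bad w \<and> (\<forall>w'. bad w' \<longrightarrow> overlap w' \<le> overlap w)"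
    by (rule Lattices_Big.ex_has_greatest_nat)
  then obtain w where w: "bad w" "\<And>w'. bad w' \<Longrightarrow> overlap w' \<le> overlap w" by blast
  obtain S T1 b where w_eq: "w = (S, T1, b)" by (metis prod_cases3)
  have S: "sylow_subgroup G p S" and T1: "sylow_subgroup G p T1" and bS: "b \<in> S"
    and bT1: "b \<in> central_power G T1 q" and bnS: "b \<notin> center_of G S"
    using w(1) by (simp_all add: w_eq bad_def)
  have max: "b' \<in> center_of G S'"
    if "sylow_subgroup G p S'" "sylow_subgroup G p T'" "b' \<in> S'" "b' \<in> central_power G T' q"
      "card (S \<inter> T1) < card (S' \<inter> T')" for S' T' b'
  proof (rule ccontr)
    assume "b' \<notin> center_of G S'"
    then have "bad (S', T', b')" using that by (simp add: bad_def)
    then show False using w(2) that(5) by (fastforce simp: w_eq overlap_def)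
  qed
  note sS = sub[OF S] and sT1 = sub[OF T1]
  have bG: "b \<in> carrier G" using bS sS by auto
  txt \<open>Replacing \<open>T1\<close> by a conjugate under \<open>C(b)\<close> keeps \<open>b\<close> a central power and makes it contain \<open>C_S(b)\<close>.\<close>
  let ?C = "{g \<in> carrier G. conj_by G g b = b}"
  note C = subgroup_element_centralizer[OF bG]
  define R where "R = S \<inter> ?C"
  have R: "subgroup R G" unfolding R_def by (rule subgroups_Inter_pair[OF sS(1) C])
  have RS: "R \<subseteq> S" and RG: "R \<subseteq> carrier G" by (auto simp: R_def)
  obtain k where cR: "card R = p ^ k"
    using card_subgroup_of_p_subgroup[OF p sS(1,4) R RS] .
  have T1C: "T1 \<subseteq> ?C" using sT1 central_power_commute[OF sT1(1) bT1] by auto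
  obtain c where c: "c \<in> ?C" "R \<subseteq> conj_by G c ` T1"
    using p_subgroup_subset_conj_sylow[OF p fin C T1 T1C R _ cR] by (auto simp: R_def)
  define T where "T = conj_by G c ` T1"
  have T: "sylow_subgroup G p T"
    unfolding T_def using c by (intro sylow_subgroup_conj_by_image[OF _ T1]) auto
  note sT = sub[OF T]
  have bT: "b \<in> central_power G T q"
    using central_power_conj_by_image[OF _ sT1(2) bT1, of c] c by (simp add: T_def)
  have RT: "R \<subseteq> T" using c by (simp add: T_def)
  \<comment> \<open>\<open>T1\<close> centralizes \<open>b\<close>, so \<open>S \<inter> T1\<close>
    lies in \<open>R\<close>. Hence Sylow subgroups meeting in strictly more than \<open>R\<close>
    overlap more than \<open>S\<close> and \<open>T1\<close>, and no counterexample is left for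
    them.\<close>
  have "card (S \<inter> T1) \<le> card R"
    using T1C sS(3) by (intro card_mono) (auto simp: R_def)
  then have max': "b' \<in> center_of G S'"
    if "sylow_subgroup G p S'" "sylow_subgroup G p T'" "b' \<in> S'" "b' \<in> central_power G T' q"
      "R \<subset> S' \<inter> T'" for S' T' b'
    using max[OF that(1-4)] psubset_card_mono[OF _ that(5)] sub(3)[OF that(1)] by auto
  have bR: "b \<in> R"
    using bS bG central_power_commute[OF sT(1) bT cp[OF T bT]] by (simp add: R_def)
  have "R \<noteq> S"
  proof
    assume "R = S"
    have "R \<subseteq> ?C" unfolding R_def by (rule Int_lower2)
    then have SC: "S \<subseteq> ?C" unfolding \<open>R = S\<close> .
    have "b \<in> center_of G S"
    proof (rule center_of_conj_by[OF sS(1) bS])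
      fix x assume "x \<in> S"
      then have "x \<in> ?C" by (rule subsetD[OF SC])
      then show "conj_by G x b = b" by simp
    qed
    then show False using bnS by simp
  qed
  then have RS': "R \<subset> S" using RS by blast
  have RT': "R \<subset> T"
    using RT psubset_card_mono[OF sS(3) RS'] sS(4) sT(4) by auto
  obtain x where x: "x \<in> S" "x \<notin> R" "conj_by G x ` R = R" "x [^] p \<in> R"
    using normalizer_p_subgroup_grows[OF p fin sS(1,4) R RS' nil[OF S]] .
  obtain t where t: "t \<in> T" "t \<notin> R" "conj_by G t ` R = R" "t [^] p \<in> R"
    using normalizer_p_subgroup_grows[OF p fin sT(1,4) R RT' nil[OF T]] .
  let ?N = "{g \<in> carrier G. conj_by G g ` R = R}"
  note N = subgroup_set_normalizer[OF RG]
  have RN: "R \<subseteq> ?N"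
  proof
    fix r assume r: "r \<in> R"
    have rG: "r \<in> carrier G" using r RG by auto
    have "conj_by G r ` R \<subseteq> R"
      using r R by (auto simp: conj_by_def subgroup.m_closed subgroup.m_inv_closed)
    then have "conj_by G r ` R = R"
      using sS(3) RS by (intro card_subset_eq) (auto simp: card_conj_by_image rG R intro: finite_subset)
    then show "r \<in> ?N" using rG by simp
  qed
  \<comment> \<open>The normalizers of \<open>R\<close> in \<open>S\<close> and in \<open>T\<close>;
    \<open>x\<close> and \<open>t\<close> show that both are larger than \<open>R\<close>.\<close>
  define Q1 where "Q1 = S \<inter> ?N"
  define Q2 where "Q2 = T \<inter> ?N"
  have Q1: "subgroup Q1 G" "Q1 \<subseteq> ?N" "Q1 \<subseteq> S" "R \<subset> Q1"
    using subgroups_Inter_pair[OF sS(1) N] RS RN x sS(2) unfolding Q1_def by auto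
  have Q2: "subgroup Q2 G" "Q2 \<subseteq> ?N" "Q2 \<subseteq> T" "R \<subset> Q2"
    using subgroups_Inter_pair[OF sT(1) N] RT RN t sT(2) unfolding Q2_def by auto
  obtain k1 where k1: "card Q1 = p ^ k1"
    using card_subgroup_of_p_subgroup[OF p sS(1,4) Q1(1,3)] .
  obtain k2 where k2: "card Q2 = p ^ k2"
    using card_subgroup_of_p_subgroup[OF p sT(1,4) Q2(1,3)] .
  obtain U a where U: "subgroup U G" "U \<subseteq> ?N" "card U = p ^ a" and
    conj: "\<And>Q k. subgroup Q G \<Longrightarrow> Q \<subseteq> ?N \<Longrightarrow> card Q = p ^ k \<Longrightarrow> \<exists>m\<in>?N. conj_by G m ` Q \<subseteq> U"
    by (rule sylow_of_subgroup[OF p fin N]) (rule that)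
  obtain m1 where m1: "m1 \<in> ?N" "conj_by G m1 ` Q1 \<subseteq> U" using conj[OF Q1(1,2) k1] by blast
  obtain m2 where m2: "m2 \<in> ?N" "conj_by G m2 ` Q2 \<subseteq> U" using conj[OF Q2(1,2) k2] by blast
  have m1G: "m1 \<in> carrier G" and m2G: "m2 \<in> carrier G" using m1 m2 by auto
  have UG: "U \<subseteq> carrier G" using U by (simp add: subgroup.subset)
  \<comment> \<open>\<open>U\<close> is a Sylow subgroup of \<open>N(R)\<close> only; it is enlarged
    to a Sylow subgroup \<open>V\<close> of \<open>G\<close>, to which maximality can be
    applied.\<close>
  obtain g where g: "g \<in> carrier G" "U \<subseteq> conj_by G g ` S"
    using p_subgroup_subset_conj_sylow[OF p fin subgroup_self S sS(2) U(1) UG U(3)] .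
  define V where "V = conj_by G g ` S"
  have V: "sylow_subgroup G p V" unfolding V_def by (rule sylow_subgroup_conj_by_image[OF g(1) S])
  note sV = sub[OF V]
  have UV: "U \<subseteq> V" unfolding V_def by (rule g(2))
  txt \<open>\<open>S1\<close> and \<open>T2\<close> are conjugate under \<open>N(R)\<close> and meet \<open>S\<close> and \<open>T\<close>, respectively, in more than \<open>R\<close>.\<close>
  define S1 where "S1 = conj_by G (inv m1) ` V"
  define T2 where "T2 = conj_by G (inv m2) ` V"
  have S1: "sylow_subgroup G p S1" and T2: "sylow_subgroup G p T2"
    unfolding S1_def T2_def using m1G m2G V by (simp_all add: sylow_subgroup_conj_by_image)
  have Q1S1: "Q1 \<subseteq> S1"
    unfolding S1_def using conj_by_image_subset_iff[OF m1G _ sV(2), of Q1] Q1(2) m1(2) UV by blast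
  have Q2T2: "Q2 \<subseteq> T2"
    unfolding T2_def using conj_by_image_subset_iff[OF m2G _ sV(2), of Q2] Q2(2) m2(2) UV by blast
  \<comment> \<open>\<open>T2\<close> and \<open>T\<close> share \<open>Q2\<close>, which is larger
    than \<open>R\<close>, so maximality makes \<open>b\<close> central in
    \<open>T2\<close>.\<close>
  have "b \<in> center_of G T2"
    using Q2T2 Q2 bR by (intro max'[OF T2 T _ bT]) auto
  then have bT2: "b \<in> central_power G T2 q"
    by (rule central_power_sylow_transfer[OF p fin T2 T bT])
  \<comment> \<open>This element of \<open>N(R)\<close> takes \<open>T2\<close> to \<open>V\<close>
    and then to \<open>S1\<close>.\<close>
  define m where "m = inv m1 \<otimes> m2"
  have m: "m \<in> ?N" unfolding m_def
    using m1(1) m2(1) by (intro subgroup.m_closed[OF N] subgroup.m_inv_closed[OF N])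
  then have mG: "m \<in> carrier G" by simp
  have "conj_by G m ` T2 = S1"
  proof -
    have "conj_by G m ` T2 = (\<lambda>v. conj_by G (inv m1) v) ` V"
      unfolding T2_def image_image
    proof (rule image_cong[OF refl])
      fix v assume "v \<in> V"
      then have "v \<in> carrier G" using sV by auto
      then show "conj_by G m (conj_by G (inv m2) v) = conj_by G (inv m1) v"
        using m1G m2G by (simp add: m_def conj_by_conj_by m_assoc)
    qed
    then show ?thesis by (simp add: S1_def)
  qed
  then have b1S1: "conj_by G m b \<in> central_power G S1 q"
    using central_power_conj_by_image[OF mG _ bT2] sub(2)[OF T2] by simp
  have b1R: "conj_by G m b \<in> R" using m bR by blast
  \<comment> \<open>The same argument for \<open>S\<close> and \<open>S1\<close>, which share
    \<open>Q1\<close>, with \<open>b\<close> replaced by its conjugate.\<close>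
  have "conj_by G m b \<in> center_of G S"
    using b1R RS Q1S1 Q1 by (intro max'[OF S S1 _ b1S1]) auto
  then have "conj_by G m b \<in> central_power G S q"
    by (rule central_power_sylow_transfer[OF p fin S S1 b1S1])
  then obtain y1 where y1: "y1 \<in> center_of G S" "conj_by G m b = y1 [^] q"
    by (auto simp: central_power_def)
  have y1S: "y1 \<in> S" using y1(1) by (rule center_of_mem)
  then have y1G: "y1 \<in> carrier G" using sS by auto
  \<comment> \<open>Being central in \<open>S\<close>, \<open>y1\<close> commutes with
    \<open>b\<close>, and \<open>R\<close> is the centralizer of \<open>b\<close> in
    \<open>S\<close>.\<close>
  have "y1 \<in> R"
    using center_of_comm[OF y1(1) bS] y1S y1G bG by (simp add: R_def conj_by_eq_iff_commute)
  then have y1Z: "y1 \<in> center_of G R"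
    using center_of_comm[OF y1(1)] RS by (intro center_ofI) auto
  \<comment> \<open>Conjugating back by \<open>inv m\<close> turns the root of the conjugate into a
    root of \<open>b\<close>. As \<open>m\<close> normalizes \<open>R\<close> but perhaps not
    \<open>S\<close>, only centrality in \<open>R\<close> is carried over.\<close>
  define y where "y = conj_by G (inv m) y1"
  have "inv m \<in> ?N" using m by (rule subgroup.m_inv_closed[OF N])
  then have yZ: "y \<in> center_of G R"
    using center_of_conj_by_image[OF _ RG y1Z, of "inv m"] by (simp add: y_def)
  have "y [^] q = conj_by G (inv m) (conj_by G m b)"
    unfolding y1(2) y_def using mG y1G by (simp add: conj_by_nat_pow)
  then have yb: "y [^] (p ^ n) = b" using mG bG by (simp add: q_def)
  have "conj_by G x (y [^] (p ^ n)) = y [^] (p ^ n)"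
    by (rule prime_power_centralized[OF p sS(1) R RS nil[OF S] x(1,3,4) yZ])
  then have "x \<in> R" using x(1) sS(2) by (auto simp: yb R_def)
  then show False using x(2) by simp
qed

end

section \<open>Strong closure of the central powers\<close>

theorem theorem1p4:
  fixes G (structure) and p n :: nat and P :: "'a set"
  assumes "Factorial_Ring.prime p"
    and "group G" and "finite (carrier G)"
    and "sylow_subgroup G p P"
    and "\<not> abelian_set G P"
    and "nilpotence_class_le G P (n * (p - 1) + 1)"
    and "\<forall>A. strongly_closed G P A \<and> abelian_set G A \<longrightarrow> A = {\<one>}"
  shows "\<forall>z\<in>center_of G P. z [^] (p ^ n) = \<one>"
proof -
  interpret group G by fact
  note p = assms(1) and fin = assms(3) and P = assms(4)
  let ?A = "central_power G P (p ^ n)"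
  have sP: "subgroup P G" using P by (simp add: sylow_subgroup_def)
  then have PG: "P \<subseteq> carrier G" by (rule subgroup.subset)
  have Z: "subgroup (center_of G P) G" using sP by (rule subgroup_center_of)
  have ZP: "center_of G P \<subseteq> P" using center_of_mem by blast
  have ZG: "center_of G P \<subseteq> carrier G" using ZP PG by blast
  have AZ: "?A \<subseteq> center_of G P" using sP by (rule central_power_subset_center)
  have "abelian_set G ?A"
    unfolding abelian_set_def
  proof (intro ballI)
    fix x y assume "x \<in> ?A" "y \<in> ?A"
    then have "x \<in> center_of G P" "y \<in> P" using AZ ZP by auto
    then show "x \<otimes> y = y \<otimes> x" by (rule center_of_comm)
  qed
  moreover have "subgroup ?A G"
  proof (rule subgroupI)
    show "?A \<subseteq> carrier G" using AZ ZG by blast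
    show "?A \<noteq> {}" using subgroup.one_closed[OF Z] by (auto simp: central_power_def)
  next
    fix a assume "a \<in> ?A"
    then obtain z where z: "z \<in> center_of G P" "a = z [^] (p ^ n)" by (auto simp: central_power_def)
    then have "inv a = (inv z) [^] (p ^ n)" using ZG by (auto simp: nat_pow_inv)
    then show "inv a \<in> ?A"
      unfolding central_power_def using subgroup.m_inv_closed[OF Z z(1)] by blast
  next
    fix a c assume "a \<in> ?A" "c \<in> ?A"
    then obtain z w where z: "z \<in> center_of G P" "a = z [^] (p ^ n)"
      and w: "w \<in> center_of G P" "c = w [^] (p ^ n)" by (auto simp: central_power_def)
    have zw: "z \<in> carrier G" "w \<in> carrier G" using z w ZG by auto
    have "w \<in> P" using w(1) by (rule center_of_mem)
    with z(1) have "z \<otimes> w = w \<otimes> z" by (rule center_of_comm)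
    then have "(z \<otimes> w) [^] (p ^ n) = z [^] (p ^ n) \<otimes> w [^] (p ^ n)"
      using zw by (rule pow_mult_distrib)
    then have "a \<otimes> c = (z \<otimes> w) [^] (p ^ n)" by (simp only: z(2) w(2))
    then show "a \<otimes> c \<in> ?A"
      unfolding central_power_def using subgroup.m_closed[OF Z z(1) w(1)] by blast
  qed
  moreover have closed: "conj_by G g a \<in> ?A"
    if a: "a \<in> ?A" and g: "g \<in> carrier G" and gP: "conj_by G g a \<in> P" for a g
  proof -
    let ?T = "conj_by G g ` P"
    have T: "sylow_subgroup G p ?T" using g P by (rule sylow_subgroup_conj_by_image)
    have b: "conj_by G g a \<in> central_power G ?T (p ^ n)"
      using g PG a by (rule central_power_conj_by_image)
    \<comment> \<open>The conjugate is a central power for the Sylow subgroup \<open>?T\<close> and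
      lies in \<open>P\<close>, hence is central in \<open>P\<close>; the transfer lemma then
      supplies a root in \<open>Z(P)\<close>.\<close>
    have "conj_by G g a \<in> center_of G P"
      using p fin sylow_class_le[OF p fin P assms(6)] P T gP b
      by (rule central_power_in_center_of_sylow)
    then show ?thesis by (rule central_power_sylow_transfer[OF p fin P T b])
  qed
  ultimately have "strongly_closed G P ?A \<and> abelian_set G ?A"
    using AZ ZP by (simp add: strongly_closed_def flip: conj_by_def)
  then have "?A = {\<one>}" by (rule assms(7)[rule_format])
  then show ?thesis by (auto simp: central_power_def)
qed

end
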